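(* Let $\mathbf{c}\in\mathbb{R}^d$ with $c_j\ne 0$ for all $j$, let $\mathbf{v}_0\in\mathbb{R}^d$ with $\mathbf{v}_0>0$ (componentwise), let $u>0$, let $f(\mathbf{x}):=e^{\mathbf{c}^{\top}\mathbf{x}}-1$ and $Q:=Q_u:=\mathbf{v}_0+u[0,1]^d$, and let $\mu$ be a concave upper bound of $f$ on $Q$. Let $P=P(f,Q)$ and $P^0=P^0(f,Q)$ be the perspective and naïve relaxations (both defined using $\mu$), and let $\Delta(P^0,P):=\operatorname{vol}(P^0)-\operatorname{vol}(P)$. Then $$\Delta(P^0,P)=\frac{1}{\prod_{j=1}^d c_j}\left(\frac{e^{\mathbf{c}^{\top}\mathbf{v}_0}\prod_{j=1}^d\left(e^{uc_j}-1\right)}{d+2}-\int_{0}^1 e^{z\mathbf{c}^{\top}\mathbf{v}_0}\prod_{j=1}^d\left(e^{zuc_j}-1\right)dz\right)+\frac{u^d}{(d+1)(d+2)}.$$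
   Context: A concave upper bound of $f$ on $Q$ is a concave function $\mu:Q\to\mathbb{R}$ with $\mu(\mathbf{x})\ge f(\mathbf{x})$ for all $\mathbf{x}\in Q$. For $z>0$ and $\mathbf{x}\in z\cdot Q=\{z\mathbf{q}:\mathbf{q}\in Q\}$ write $\tilde f(\mathbf{x},z):=z f(\mathbf{x}/z)$ and $\tilde\mu(\mathbf{x},z):=z\mu(\mathbf{x}/z)$, and (closure convention) $\tilde\mu(\mathbf{0},0):=0$. The perspective relaxation is $$P(f,Q):=\operatorname{convcl}\{(\mathbf{x},y,z)\in\mathbb{R}^d\times\mathbb{R}\times\mathbb{R}:\ \tilde\mu(\mathbf{x},z)\ge y\ge\tilde f(\mathbf{x},z),\ \mathbf{x}\in z\cdot Q,\ 1\ge z>0\},$$ where $\operatorname{convcl}$ denotes the closure of the convex hull, and the naïve relaxation is $$P^0(f,Q):=\{(\mathbf{x},y,z)\in\mathbb{R}^d\times\mathbb{R}\times\mathbb{R}:\ \tilde\mu(\mathbf{x},z)\ge y\ge f(\mathbf{x}),\ \mathbf{x}\in z\cdot Q,\ 1\ge z\ge 0\}.$$ $\operatorname{vol}$ denotes Lebesgue measure in $\mathbb{R}^{d+2}$. *)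

theory Defs
  imports "HOL-Analysis.Analysis"
begin

definition concave_upper_bound ::
  "('a::real_vector \<Rightarrow> real) \<Rightarrow> 'a set \<Rightarrow> ('a \<Rightarrow> real) \<Rightarrow> bool" where
  "concave_upper_bound f Q \<mu> \<longleftrightarrow> concave_on Q \<mu> \<and> (\<forall>x\<in>Q. \<mu> x \<ge> f x)"

text \<open>At \<open>z = 0\<close> the factor \<open>z\<close> makes the value \<open>0\<close>, which is
  the closure convention at the point \<open>(0, 0)\<close>.\<close>

definition perspective :: "('a::real_vector \<Rightarrow> real) \<Rightarrow> 'a \<Rightarrow> real \<Rightarrow> real" where
  "perspective g x z = z * g (x /\<^sub>R z)"

definition perspective_relaxation ::
  "('a::real_normed_vector \<Rightarrow> real) \<Rightarrow> ('a \<Rightarrow> real) \<Rightarrow> 'a set \<Rightarrow> ('a \<times> real \<times> real) set" where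
  "perspective_relaxation f \<mu> Q = closure (convex hull
     {(x, y, z). perspective \<mu> x z \<ge> y \<and> y \<ge> perspective f x z \<and>
        x \<in> (\<lambda>q. z *\<^sub>R q) ` Q \<and> 1 \<ge> z \<and> z > 0})"

definition naive_relaxation ::
  "('a::real_vector \<Rightarrow> real) \<Rightarrow> ('a \<Rightarrow> real) \<Rightarrow> 'a set \<Rightarrow> ('a \<times> real \<times> real) set" where
  "naive_relaxation f \<mu> Q =
     {(x, y, z). perspective \<mu> x z \<ge> y \<and> y \<ge> f x \<and>
        x \<in> (\<lambda>q. z *\<^sub>R q) ` Q \<and> 1 \<ge> z \<and> z \<ge> 0}"

abbreviation vol :: "'a::euclidean_space set \<Rightarrow> real" where
  "vol \<equiv> measure lebesgue"

definition \<Delta> :: "'a::euclidean_space set \<Rightarrow> 'a set \<Rightarrow> real" where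
  "\<Delta> A B = vol A - vol B"

definition shifted_cube :: "real^'n \<Rightarrow> real \<Rightarrow> (real^'n) set" where
  "shifted_cube v\<^sub>0 u = {v\<^sub>0 + u *\<^sub>R t | t. \<forall>j. 0 \<le> t $ j \<and> t $ j \<le> 1}"

end

theory Submission
  imports Defs
begin

text \<open>Let \<open>S\<close> be the set whose closed convex hull is the perspective relaxation. It consists of the points
  \<open>(z q, z w, z)\<close> with \<open>0 < z \<le> 1\<close> and \<open>(q, w)\<close> in the convex region between the graphs of \<open>f\<close> and \<open>\<mu>\<close>
  over \<open>Q\<close>, so \<open>S\<close> is convex already (\<open>convex_perspective_body\<close>). It is bounded, because a concave
  function that is bounded below on a cube is bounded above there, as one sees by reflecting in the centre
  (\<open>concave_on_symmetric_le\<close>). The frontier of a convex set is negligible, so \<open>S\<close> has the volume of the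
  perspective relaxation, and this volume is finite.

  Since \<open>f\<close> is convex with \<open>f 0 = 0\<close>, it lies below its perspective for \<open>0 < z \<le> 1\<close>. Hence, apart
  from the origin, the naive relaxation is the disjoint union of \<open>S\<close> and the gap
  \<open>f x \<le> y < z f (x / z)\<close> over the cone on \<open>Q\<close> (\<open>naive_relaxation_decomposition\<close>). The difference of
  the volumes is thus the volume of the gap, which does not involve \<open>\<mu>\<close>
  (\<open>Delta_relaxations_eq\<close>).

  By Tonelli's theorem the volume of the gap is the integral over \<open>z \<in> [0, 1]\<close> of the integral of
  \<open>z f (x / z) - f x\<close> over the cube \<open>z Q\<close>. The exponential of a linear form is a product of functions of
  one coordinate, so the inner integral has a closed form (\<open>has_bochner_integral_gap_section\<close>). Integrating
  the powers of \<open>z\<close> in it gives the claim (\<open>has_integral_gap_section\<close>).\<close>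

section \<open>Convex and concave functions\<close>

text \<open>If \<open>Q\<close> is symmetric about \<open>m\<close>, then \<open>m\<close> is the midpoint of \<open>q\<close> and its reflection, and
  concavity at \<open>m\<close> bounds \<open>\<mu> q\<close> from above by means of a lower bound at the reflection.\<close>
lemma concave_on_symmetric_le:
  fixes m :: "'a::real_vector"
  assumes \<mu>: "concave_on Q \<mu>" and sym: "\<And>q. q \<in> Q \<Longrightarrow> 2 *\<^sub>R m - q \<in> Q"
    and L: "\<And>q. q \<in> Q \<Longrightarrow> L \<le> \<mu> q" and q: "q \<in> Q"
  shows "\<mu> q \<le> 2 * \<mu> m - L"
proof -
  have "(1/2) * \<mu> q + (1/2) * \<mu> (2 *\<^sub>R m - q) \<le> \<mu> ((1/2) *\<^sub>R q + (1/2) *\<^sub>R (2 *\<^sub>R m - q))"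
    using \<mu>[unfolded concave_on_iff, THEN conjunct2, rule_format, OF q sym[OF q], of "1/2" "1/2"]
    by simp
  also have "(1/2) *\<^sub>R q + (1/2) *\<^sub>R (2 *\<^sub>R m - q) = m"
    by (simp add: scaleR_right_diff_distrib)
  finally show ?thesis using L[OF sym[OF q]] by simp
qed

lemma perspective_convex_ge:
  assumes f: "convex_on UNIV f" and f0: "f 0 \<le> 0" and z: "0 < z" "z \<le> 1"
  shows "f x \<le> perspective f x z"
proof -
  have "f (z *\<^sub>R (x /\<^sub>R z) + (1 - z) *\<^sub>R 0) \<le> z * f (x /\<^sub>R z) + (1 - z) * f 0"
    using f[unfolded convex_on_def, THEN conjunct2, rule_format, of "x /\<^sub>R z" 0 z "1 - z"] z
    by simp
  also have "\<dots> \<le> z * f (x /\<^sub>R z)"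
    using f0 z by (simp add: mult_nonneg_nonpos)
  finally show ?thesis using z by (simp add: perspective_def)
qed

lemma convex_on_exp_inner:
  fixes c :: "'a::real_inner"
  shows "convex_on UNIV (\<lambda>x. exp (c \<bullet> x) - 1)"
proof (rule convex_onI)
  fix t :: real and x y :: 'a
  assume t: "0 < t" "t < 1"
  have "exp ((1 - t) * (c \<bullet> x) + t * (c \<bullet> y)) \<le> (1 - t) * exp (c \<bullet> x) + t * exp (c \<bullet> y)"
    using convex_onD[OF exp_convex, of t "c \<bullet> x" "c \<bullet> y"] t by simp
  then show "exp (c \<bullet> ((1 - t) *\<^sub>R x + t *\<^sub>R y)) - 1
      \<le> (1 - t) * (exp (c \<bullet> x) - 1) + t * (exp (c \<bullet> y) - 1)"
    by (simp add: inner_add_right algebra_simps)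
qed simp

section \<open>The perspective relaxation before taking the closure\<close>

text \<open>The set of points that generates the perspective relaxation, parametrized so that its slice at height
  \<open>z\<close> is visibly the \<open>z\<close>-fold dilate of the region between the graphs of \<open>f\<close> and \<open>\<mu>\<close> over
  \<open>Q\<close>. The apex \<open>0\<close> is left out.\<close>
definition perspective_body ::
  "('a::real_vector \<Rightarrow> real) \<Rightarrow> ('a \<Rightarrow> real) \<Rightarrow> 'a set \<Rightarrow> ('a \<times> real \<times> real) set" where
  "perspective_body f \<mu> Q =
     {(z *\<^sub>R q, z * w, z) | q w z. q \<in> Q \<and> f q \<le> w \<and> w \<le> \<mu> q \<and> 0 < z \<and> z \<le> 1}"

lemma perspective_body_eq:
  "perspective_body f \<mu> Q = {(x, y, z). perspective \<mu> x z \<ge> y \<and> y \<ge> perspective f x z \<and>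
        x \<in> (\<lambda>q. z *\<^sub>R q) ` Q \<and> 1 \<ge> z \<and> z > 0}" (is "_ = ?S")
proof (intro equalityI subsetI)
  fix p assume "p \<in> perspective_body f \<mu> Q"
  then show "p \<in> ?S"
    by (auto simp: perspective_body_def perspective_def mult_left_mono)
next
  fix p assume "p \<in> ?S"
  then obtain q y z where p: "p = (z *\<^sub>R q, y, z)" "q \<in> Q" "0 < z" "z \<le> 1"
    and y: "z * f q \<le> y" "y \<le> z * \<mu> q"
    by (auto simp: perspective_def)
  have "p = (z *\<^sub>R q, z * (y / z), z)" "f q \<le> y / z" "y / z \<le> \<mu> q"
    using p y by (auto simp: field_simps)
  then show "p \<in> perspective_body f \<mu> Q"
    unfolding perspective_body_def using p by blast
qed

lemma convex_perspective_body:
  assumes f: "convex_on Q f" and \<mu>: "concave_on Q \<mu>"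
  shows "convex (perspective_body f \<mu> Q)"
proof (rule convexI)
  fix p1 p2 :: "'a \<times> real \<times> real" and a b :: real
  assume p1: "p1 \<in> perspective_body f \<mu> Q" and p2: "p2 \<in> perspective_body f \<mu> Q"
    and ab: "0 \<le> a" "0 \<le> b" "a + b = 1"
  obtain q1 w1 z1 where 1: "p1 = (z1 *\<^sub>R q1, z1 * w1, z1)" "q1 \<in> Q" "f q1 \<le> w1" "w1 \<le> \<mu> q1"
    "0 < z1" "z1 \<le> 1"
    using p1 by (auto simp: perspective_body_def)
  obtain q2 w2 z2 where 2: "p2 = (z2 *\<^sub>R q2, z2 * w2, z2)" "q2 \<in> Q" "f q2 \<le> w2" "w2 \<le> \<mu> q2"
    "0 < z2" "z2 \<le> 1"
    using p2 by (auto simp: perspective_body_def)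
  define z where "z = a * z1 + b * z2"
  have z: "0 < z" "z \<le> 1"
  proof -
    show "0 < z"
    proof (cases "a = 0")
      case False
      then show ?thesis unfolding z_def using ab 1 2 by (intro add_pos_nonneg) auto
    qed (use ab 2 in \<open>auto simp: z_def\<close>)
    have "z \<le> a * 1 + b * 1"
      unfolding z_def using ab 1 2 by (intro add_mono mult_left_mono) auto
    then show "z \<le> 1" using ab by simp
  qed
  \<comment> \<open>The base point of the combination is the average of \<open>q1\<close> and \<open>q2\<close> with weights
    proportional to \<open>a z1\<close> and \<open>b z2\<close>.\<close>
  define s t where "s = a * z1 / z" and "t = b * z2 / z"
  have st: "0 \<le> s" "0 \<le> t" "s + t = 1" "z * s = a * z1" "z * t = b * z2"
    using ab 1 2 z by (auto simp: s_def t_def z_def simp flip: add_divide_distrib)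
  define q w where "q = s *\<^sub>R q1 + t *\<^sub>R q2" and "w = s * w1 + t * w2"
  have "convex Q" using f by (simp add: convex_on_def)
  then have "q \<in> Q" unfolding q_def using 1 2 st by (simp add: convexD)
  moreover have "f q \<le> w"
  proof -
    have "f q \<le> s * f q1 + t * f q2"
      unfolding q_def using f 1 2 st by (simp add: convex_on_def)
    also have "\<dots> \<le> w"
      unfolding w_def using 1 2 st by (intro add_mono mult_left_mono) auto
    finally show ?thesis .
  qed
  moreover have "w \<le> \<mu> q"
  proof -
    have "w \<le> s * \<mu> q1 + t * \<mu> q2"
      unfolding w_def using 1 2 st by (intro add_mono mult_left_mono) auto
    also have "\<dots> \<le> \<mu> q"
      unfolding q_def using \<mu> 1 2 st by (simp add: concave_on_iff)
    finally show ?thesis .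
  qed
  moreover have "a *\<^sub>R p1 + b *\<^sub>R p2 = (z *\<^sub>R q, z * w, z)"
    using st by (simp add: 1 2 q_def w_def z_def[symmetric] scaleR_right_distrib distrib_left
        flip: mult.assoc)
  ultimately show "a *\<^sub>R p1 + b *\<^sub>R p2 \<in> perspective_body f \<mu> Q"
    unfolding perspective_body_def using z by blast
qed

lemma bounded_perspective_body:
  fixes Q :: "'a::real_normed_vector set"
  assumes Q: "bounded Q" and f: "\<And>q. q \<in> Q \<Longrightarrow> L \<le> f q" and \<mu>: "\<And>q. q \<in> Q \<Longrightarrow> \<mu> q \<le> U"
  shows "bounded (perspective_body f \<mu> Q)"
proof -
  obtain B where B: "0 < B" "\<And>q. q \<in> Q \<Longrightarrow> norm q \<le> B"
    using Q by (auto simp: bounded_pos)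
  define K where "K = max \<bar>L\<bar> \<bar>U\<bar>"
  have "perspective_body f \<mu> Q \<subseteq> cball 0 B \<times> cball 0 K \<times> cball 0 1"
  proof
    fix p assume "p \<in> perspective_body f \<mu> Q"
    then obtain q w z where p: "p = (z *\<^sub>R q, z * w, z)" "q \<in> Q" "f q \<le> w" "w \<le> \<mu> q"
      "0 < z" "z \<le> 1"
      by (auto simp: perspective_body_def)
    have "\<bar>w\<bar> \<le> K" using p f[of q] \<mu>[of q] by (auto simp: K_def)
    then have "z * \<bar>w\<bar> \<le> 1 * K" using p by (intro mult_mono) auto
    moreover have "z * norm q \<le> 1 * B" using p B by (intro mult_mono) auto
    ultimately show "p \<in> cball 0 B \<times> cball 0 K \<times> cball 0 1"
      using p by (auto simp: abs_mult)
  qed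
  then show ?thesis
    by (rule bounded_subset[rotated]) (intro bounded_Times bounded_cball)
qed

section \<open>The difference of the two relaxations\<close>

text \<open>The points over the cone on \<open>Q\<close> that lie above the graph of \<open>f\<close> and strictly below the graph of
  the perspective of \<open>f\<close>. The strict inequality makes the set disjoint from \<open>perspective_body\<close>.\<close>
definition lower_gap ::
  "('a::real_vector \<Rightarrow> real) \<Rightarrow> 'a set \<Rightarrow> ('a \<times> real \<times> real) set" where
  "lower_gap f Q = {(x, y, z). x \<in> (\<lambda>q. z *\<^sub>R q) ` Q \<and> 0 < z \<and> z \<le> 1 \<and>
     f x \<le> y \<and> y < perspective f x z}"

lemma naive_relaxation_decomposition:
  assumes f: "convex_on UNIV f" and f0: "f 0 = 0" and Q: "Q \<noteq> {}"
    and f\<mu>: "\<And>q. q \<in> Q \<Longrightarrow> f q \<le> \<mu> q"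
  shows "naive_relaxation f \<mu> Q = insert 0 (perspective_body f \<mu> Q \<union> lower_gap f Q)"
    and "perspective_body f \<mu> Q \<inter> lower_gap f Q = {}"
proof -
  have "(x, y, z) \<in> naive_relaxation f \<mu> Q \<longleftrightarrow>
      (x, y, z) \<in> insert 0 (perspective_body f \<mu> Q \<union> lower_gap f Q)" for x y z
  proof (cases "0 < z \<and> z \<le> 1 \<and> x \<in> (\<lambda>q. z *\<^sub>R q) ` Q")
    case True
    then have "f x \<le> perspective f x z"
      using perspective_convex_ge[OF f, of z x] f0 by simp
    moreover have "perspective f x z \<le> perspective \<mu> x z"
      using True f\<mu> by (auto simp: perspective_def mult_left_mono)
    moreover have "(x, y, z) \<noteq> 0" using True by (simp add: zero_prod_def)
    ultimately show ?thesis
      using True by (auto simp: naive_relaxation_def perspective_body_eq lower_gap_def)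
  next
    case False
    \<comment> \<open>The only remaining point of the naive relaxation is the origin, at height \<open>z = 0\<close>.\<close>
    then show ?thesis using Q f0
      by (auto simp: naive_relaxation_def perspective_body_eq lower_gap_def perspective_def
          image_iff zero_prod_def)
  qed
  then show "naive_relaxation f \<mu> Q = insert 0 (perspective_body f \<mu> Q \<union> lower_gap f Q)"
    by auto
  show "perspective_body f \<mu> Q \<inter> lower_gap f Q = {}"
    by (auto simp: perspective_body_eq lower_gap_def)
qed

theorem Delta_relaxations_eq:
  fixes Q :: "'a::euclidean_space set"
  assumes f: "convex_on UNIV f" and f0: "f 0 = 0" and Q: "convex Q" "bounded Q" "Q \<noteq> {}"
    and L: "\<And>q. q \<in> Q \<Longrightarrow> L \<le> f q" and U: "\<And>q. q \<in> Q \<Longrightarrow> \<mu> q \<le> U"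
    and \<mu>: "concave_upper_bound f Q \<mu>" and gap: "lower_gap f Q \<in> lmeasurable"
  shows "\<Delta> (naive_relaxation f \<mu> Q) (perspective_relaxation f \<mu> Q) = vol (lower_gap f Q)"
proof -
  let ?S = "perspective_body f \<mu> Q"
  have conc: "concave_on Q \<mu>" and f\<mu>: "\<And>q. q \<in> Q \<Longrightarrow> f q \<le> \<mu> q"
    using \<mu> by (auto simp: concave_upper_bound_def)
  have cS: "convex ?S"
    using f Q(1) conc by (intro convex_perspective_body) (auto simp: convex_on_def)
  have bS: "bounded ?S" by (rule bounded_perspective_body[OF Q(2) L U])
  have "perspective_relaxation f \<mu> Q = closure ?S"
    unfolding perspective_relaxation_def perspective_body_eq[symmetric]
    using cS by (simp add: hull_same)
  then have P: "vol (perspective_relaxation f \<mu> Q) = vol ?S"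
    using measure_closure[OF bS negligible_convex_frontier[OF cS]] by simp
  have S: "?S \<in> lmeasurable" by (rule measurable_convex[OF cS bS])
  have "vol (naive_relaxation f \<mu> Q) = vol (?S \<union> lower_gap f Q)"
    by (rule measure_negligible_symdiff[OF fmeasurable.Un[OF S gap]])
       (rule negligible_subset[OF negligible_sing[of 0]],
        use naive_relaxation_decomposition(1)[OF f f0 Q(3), of \<mu>] f\<mu> in auto)
  also have "\<dots> = vol ?S + vol (lower_gap f Q)"
    using naive_relaxation_decomposition(2)[OF f f0 Q(3) f\<mu>] S gap
    by (intro measure_Un_AE) auto
  finally show ?thesis by (simp add: \<Delta>_def P)
qed

section \<open>Integrals of exponentials over boxes\<close>

lemma has_bochner_integral_exp_inner_box:
  fixes a l h :: "'a::euclidean_space"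
  assumes a: "\<And>b. b \<in> Basis \<Longrightarrow> a \<bullet> b \<noteq> 0" and lh: "\<And>b. b \<in> Basis \<Longrightarrow> l \<bullet> b \<le> h \<bullet> b"
  shows "has_bochner_integral lborel (\<lambda>x. indicator (cbox l h) x * exp (a \<bullet> x))
    (\<Prod>b\<in>Basis. (exp ((a \<bullet> b) * (h \<bullet> b)) - exp ((a \<bullet> b) * (l \<bullet> b))) / (a \<bullet> b))"
proof -
  define F where "F b t = exp ((a \<bullet> b) * t) * indicator {l \<bullet> b .. h \<bullet> b} t" for b t
  define I where "I b = (exp ((a \<bullet> b) * (h \<bullet> b)) - exp ((a \<bullet> b) * (l \<bullet> b))) / (a \<bullet> b)" for b
  have I: "(\<integral>\<^sup>+t. ennreal (F b t) \<partial>lborel) = ennreal (I b)" "0 \<le> I b" if b: "b \<in> Basis" for b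
  proof -
    have "((\<lambda>t. exp ((a \<bullet> b) * t) / (a \<bullet> b)) has_real_derivative exp ((a \<bullet> b) * t)) (at t)" for t
      using a[OF b] by (auto intro!: derivative_eq_intros)
    then have "has_bochner_integral lborel (F b)
        (exp ((a \<bullet> b) * (h \<bullet> b)) / (a \<bullet> b) - exp ((a \<bullet> b) * (l \<bullet> b)) / (a \<bullet> b))"
      unfolding F_def by (intro has_bochner_integral_FTC_Icc_nonneg) (use lh[OF b] in auto)
    then have hb: "has_bochner_integral lborel (F b) (I b)"
      by (simp add: I_def diff_divide_distrib)
    have F0: "0 \<le> F b t" for t by (simp add: F_def)
    show "(\<integral>\<^sup>+t. ennreal (F b t) \<partial>lborel) = ennreal (I b)"
      using hb F0 by (simp add: has_bochner_integral_iff nn_integral_eq_integral)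
    have "0 \<le> integral\<^sup>L lborel (F b)"
      using F0 by (intro Bochner_Integration.integral_nonneg)
    then show "0 \<le> I b"
      using hb by (simp add: has_bochner_integral_iff)
  qed
  have eq: "(\<Prod>b\<in>Basis. F b (x \<bullet> b)) = indicator (cbox l h) x * exp (a \<bullet> x)" for x
  proof -
    have "(\<Prod>b\<in>Basis. F b (x \<bullet> b))
        = (\<Prod>b\<in>Basis. exp ((a \<bullet> b) * (x \<bullet> b))) * (\<Prod>b\<in>Basis. indicator {l \<bullet> b .. h \<bullet> b} (x \<bullet> b))"
      unfolding F_def by (rule prod.distrib)
    also have "(\<Prod>b\<in>Basis. exp ((a \<bullet> b) * (x \<bullet> b))) = exp (a \<bullet> x)"
      by (subst euclidean_inner) (rule exp_sum[OF finite_Basis, symmetric])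
    also have "(\<Prod>b\<in>Basis. indicator {l \<bullet> b .. h \<bullet> b} (x \<bullet> b)) = (indicator (cbox l h) x :: real)"
      by (cases "x \<in> cbox l h") (auto simp: mem_box indicator_def)
    finally show ?thesis by simp
  qed
  have "(\<integral>\<^sup>+x. ennreal (indicator (cbox l h) x * exp (a \<bullet> x)) \<partial>lborel)
      = (\<integral>\<^sup>+x. (\<Prod>b\<in>Basis. ennreal (F b (x \<bullet> b))) \<partial>lborel)"
    by (subst prod_ennreal) (auto simp: F_def simp flip: eq)
  also have "\<dots> = (\<Prod>b\<in>Basis. \<integral>\<^sup>+t. ennreal (F b t) \<partial>lborel)"
    by (rule nn_integral_lborel_prod) (auto simp: F_def)
  also have "\<dots> = (\<Prod>b\<in>Basis. ennreal (I b))"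
    by (rule prod.cong) (auto simp: I)
  also have "\<dots> = ennreal (\<Prod>b\<in>Basis. I b)"
    by (rule prod_ennreal) (auto simp: I)
  finally show ?thesis
    unfolding I_def by (intro has_bochner_integral_nn_integral) (auto intro!: prod_nonneg I[unfolded I_def])
qed

lemma has_bochner_integral_exp_inner_box_cart:
  fixes a l h :: "real^'n"
  assumes a: "\<And>j. a $ j \<noteq> 0" and lh: "\<And>j. l $ j \<le> h $ j"
  shows "has_bochner_integral lborel (\<lambda>x. indicator (cbox l h) x * exp (a \<bullet> x))
    (\<Prod>j\<in>UNIV. (exp (a $ j * h $ j) - exp (a $ j * l $ j)) / a $ j)"
proof -
  have B: "(Basis :: (real^'n) set) = range (\<lambda>j. axis j 1)"
    by (auto simp: Basis_vec_def)
  have inj: "inj (\<lambda>j. axis j 1 :: real^'n)"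
    by (auto simp: inj_on_def axis_eq_axis)
  have "has_bochner_integral lborel (\<lambda>x. indicator (cbox l h) x * exp (a \<bullet> x))
      (\<Prod>b\<in>Basis. (exp ((a \<bullet> b) * (h \<bullet> b)) - exp ((a \<bullet> b) * (l \<bullet> b))) / (a \<bullet> b))"
    by (rule has_bochner_integral_exp_inner_box)
       (use a lh in \<open>auto simp: B cart_eq_inner_axis[symmetric]\<close>)
  then show ?thesis
    by (simp add: B prod.reindex[OF inj] o_def cart_eq_inner_axis[symmetric])
qed

lemma has_bochner_integral_exp_scaled_cube:
  fixes a v :: "real^'n"
  assumes a: "\<And>j. a $ j \<noteq> 0" and u: "0 \<le> u" and z: "0 \<le> z"
  shows "has_bochner_integral lborel
    (\<lambda>x. indicator (cbox (z *\<^sub>R v) (\<chi> j. z * (v $ j + u))) x * exp (a \<bullet> x))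
    (exp (z * (a \<bullet> v)) * (\<Prod>j\<in>UNIV. exp (z * u * a $ j) - 1) / (\<Prod>j\<in>UNIV. a $ j))"
proof -
  have "exp (z * (a \<bullet> v)) = (\<Prod>j\<in>UNIV. exp (z * (a $ j * v $ j)))"
    by (simp add: inner_vec_def sum_distrib_left exp_sum)
  then have "(\<Prod>j\<in>UNIV. (exp (a $ j * (z * (v $ j + u))) - exp (a $ j * (z * v $ j))) / a $ j)
      = exp (z * (a \<bullet> v)) * (\<Prod>j\<in>UNIV. exp (z * u * a $ j) - 1) / (\<Prod>j\<in>UNIV. a $ j)"
    by (simp add: prod.distrib[symmetric] prod_dividef[symmetric] algebra_simps flip: exp_add)
  moreover have "has_bochner_integral lborel
      (\<lambda>x. indicator (cbox (z *\<^sub>R v) (\<chi> j. z * (v $ j + u))) x * exp (a \<bullet> x))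
      (\<Prod>j\<in>UNIV. (exp (a $ j * (\<chi> j. z * (v $ j + u)) $ j) - exp (a $ j * (z *\<^sub>R v) $ j)) / a $ j)"
    by (rule has_bochner_integral_exp_inner_box_cart) (use a u z in \<open>auto simp: mult_left_mono\<close>)
  ultimately show ?thesis by simp
qed

lemma has_bochner_integral_scaled_cube:
  fixes v :: "real^'n"
  assumes u: "0 \<le> u" and z: "0 \<le> z"
  shows "has_bochner_integral lborel
    (indicator (cbox (z *\<^sub>R v) (\<chi> j. z * (v $ j + u))) :: _ \<Rightarrow> real) ((z * u) ^ CARD('n))"
proof -
  let ?B = "cbox (z *\<^sub>R v) (\<chi> j. z * (v $ j + u))"
  have "z *\<^sub>R v \<in> ?B"
    using u z by (simp add: mem_box_cart mult_left_mono)
  then have "measure lborel ?B = (\<Prod>j\<in>UNIV. z * (v $ j + u) - z * v $ j)"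
    by (subst content_cbox_cart) auto
  also have "\<dots> = (z * u) ^ CARD('n)"
    by (simp add: algebra_simps)
  finally have m: "measure lborel ?B = (z * u) ^ CARD('n)" .
  have "has_bochner_integral lborel (indicator ?B :: _ \<Rightarrow> real) (measure lborel ?B)"
    by (intro has_bochner_integral_real_indicator) (auto simp: emeasure_lborel_cbox_eq)
  then show ?thesis unfolding m .
qed

section \<open>Volume of a region between two graphs\<close>

text \<open>The coordinate bounded by the two graphs is the middle one, to match the order of the components in the
  relaxations. The last coordinate is integrated outermost, so that its slices can be treated one at a
  time.\<close>
lemma emeasure_region_between_graphs:
  fixes A :: "('a::euclidean_space \<times> real) set" and g h :: "'a \<times> real \<Rightarrow> real"
  assumes [measurable]: "A \<in> sets borel" "g \<in> borel_measurable borel" "h \<in> borel_measurable borel"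
  defines "D \<equiv> {(x, y, z). (x, z) \<in> A \<and> g (x, z) \<le> y \<and> y < h (x, z)}"
  assumes gh: "\<And>p. p \<in> A \<Longrightarrow> g p \<le> h p"
  shows "D \<in> sets borel"
    and "emeasure lborel D
      = (\<integral>\<^sup>+z. (\<integral>\<^sup>+x. ennreal (indicator A (x, z) * (h (x, z) - g (x, z))) \<partial>lborel) \<partial>lborel)"
proof -
  have [measurable]: "A \<in> sets (borel \<Otimes>\<^sub>M borel)"
      "g \<in> borel_measurable (borel \<Otimes>\<^sub>M borel)" "h \<in> borel_measurable (borel \<Otimes>\<^sub>M borel)"
    using assms(1-3) unfolding borel_prod by blast+
  have "D = {p \<in> space (borel \<Otimes>\<^sub>M (borel \<Otimes>\<^sub>M borel)).
      (fst p, snd (snd p)) \<in> A \<and> g (fst p, snd (snd p)) \<le> fst (snd p)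
         \<and> fst (snd p) < h (fst p, snd (snd p))}"
    by (auto simp: D_def space_pair_measure)
  also have "\<dots> \<in> sets (borel \<Otimes>\<^sub>M (borel \<Otimes>\<^sub>M borel))"
    by measurable
  finally have [measurable]: "D \<in> sets (borel \<Otimes>\<^sub>M (borel \<Otimes>\<^sub>M borel))" .
  then show D: "D \<in> sets borel" unfolding borel_prod .
  have slice: "(\<integral>\<^sup>+y. indicator D (x, y, z) \<partial>lborel)
      = ennreal (indicator A (x, z) * (h (x, z) - g (x, z)))" for x z
  proof (cases "(x, z) \<in> A")
    case True
    have "(\<integral>\<^sup>+y. indicator D (x, y, z) \<partial>lborel)
        = (\<integral>\<^sup>+y. indicator {g (x, z) ..< h (x, z)} y \<partial>lborel)"
      using True by (intro nn_integral_cong) (auto simp: D_def indicator_def)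
    then show ?thesis using True gh[OF True] by simp
  qed (simp add: D_def)
  have "emeasure lborel D = emeasure (lborel \<Otimes>\<^sub>M lborel) D"
    by (simp add: lborel_prod)
  also have "\<dots> = (\<integral>\<^sup>+x. \<integral>\<^sup>+p. indicator D (x, p) \<partial>lborel \<partial>lborel)"
    by (rule lborel.emeasure_pair_measure) (simp only: lborel_prod sets_lborel D)
  also have "\<dots> = (\<integral>\<^sup>+x. \<integral>\<^sup>+p. indicator D (x, p) \<partial>(lborel \<Otimes>\<^sub>M lborel) \<partial>lborel)"
    by (simp add: lborel_prod)
  also have "\<dots> = (\<integral>\<^sup>+x. \<integral>\<^sup>+z. \<integral>\<^sup>+y. indicator D (x, y, z) \<partial>lborel \<partial>lborel \<partial>lborel)"
    by (subst lborel_pair.nn_integral_snd[symmetric]) simp_all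
  also have "\<dots> = (\<integral>\<^sup>+x. \<integral>\<^sup>+z. ennreal (indicator A (x, z) * (h (x, z) - g (x, z))) \<partial>lborel \<partial>lborel)"
    by (simp add: slice)
  also have "\<dots> = (\<integral>\<^sup>+z. (\<integral>\<^sup>+x. ennreal (indicator A (x, z) * (h (x, z) - g (x, z))) \<partial>lborel) \<partial>lborel)"
    by (rule lborel_pair.Fubini'[symmetric]) simp
  finally show "emeasure lborel D = \<dots>" .
qed

section \<open>Volume of the gap for an exponential over a cube\<close>

lemma shifted_cube_eq_cbox:
  assumes "0 < u"
  shows "shifted_cube v u = cbox v (\<chi> j. v $ j + u)"
proof (intro equalityI subsetI)
  fix x assume "x \<in> shifted_cube v u"
  then show "x \<in> cbox v (\<chi> j. v $ j + u)"
    using assms by (auto simp: shifted_cube_def mem_box_cart mult_left_le)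
next
  fix x assume x: "x \<in> cbox v (\<chi> j. v $ j + u)"
  have "x = v + u *\<^sub>R ((x - v) /\<^sub>R u)" using assms by simp
  moreover have "\<forall>j. 0 \<le> ((x - v) /\<^sub>R u) $ j \<and> ((x - v) /\<^sub>R u) $ j \<le> 1"
    using x assms by (auto simp: mem_box_cart field_simps)
  ultimately show "x \<in> shifted_cube v u" unfolding shifted_cube_def by blast
qed

lemma mem_scaleR_image_cbox_cart:
  fixes x l h :: "real^'n"
  assumes "0 < z"
  shows "x \<in> (\<lambda>q. z *\<^sub>R q) ` cbox l h \<longleftrightarrow> (\<forall>j. z * l $ j \<le> x $ j \<and> x $ j \<le> z * h $ j)"
proof -
  have "x \<in> (\<lambda>q. z *\<^sub>R q) ` cbox l h \<longleftrightarrow> x /\<^sub>R z \<in> cbox l h"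
    using assms by (force simp: image_iff)
  then show ?thesis using assms by (simp add: mem_box_cart field_simps)
qed

context
  fixes c v :: "real^'n" and u :: real
begin

text \<open>The integral of \<open>exp (c \<bullet> x)\<close> over the cube \<open>z Q\<close>, with \<open>Q = shifted_cube v u\<close>, times the
  product of the coordinates of \<open>c\<close>, for \<open>z \<ge> 0\<close> and \<open>c\<close> without zero coordinate.\<close>
definition cube_exp_numerator :: "real \<Rightarrow> real" where
  "cube_exp_numerator z = exp (z * (c \<bullet> v)) * (\<Prod>j\<in>UNIV. exp (z * u * c $ j) - 1)"

text \<open>The closed form of the integral of \<open>z f (x / z) - f x\<close> over the cube \<open>z Q\<close>, for
  \<open>f x = exp (c \<bullet> x) - 1\<close> and \<open>z > 0\<close>. The \<open>(d + 1)\<close>-st powers of \<open>z\<close>, with \<open>d = CARD('n)\<close>, come from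
  the homogeneity of the perspective.\<close>
definition gap_section :: "real \<Rightarrow> real" where
  "gap_section z = (z ^ (CARD('n) + 1) * cube_exp_numerator 1 - cube_exp_numerator z) / (\<Prod>j\<in>UNIV. c $ j)
     + (z ^ CARD('n) - z ^ (CARD('n) + 1)) * u ^ CARD('n)"

lemma gap_section_0: "gap_section 0 = 0"
  by (simp add: gap_section_def cube_exp_numerator_def power_0_left)

lemma has_bochner_integral_gap_section:
  assumes c: "\<And>j. c $ j \<noteq> 0" and u: "0 \<le> u" and z: "0 < z"
  shows "has_bochner_integral lborel
    (\<lambda>x. indicator (cbox (z *\<^sub>R v) (\<chi> j. z * (v $ j + u))) x *
      (perspective (\<lambda>x. exp (c \<bullet> x) - 1) x z - (exp (c \<bullet> x) - 1))) (gap_section z)"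
proof -
  let ?I = "indicator (cbox (z *\<^sub>R v) (\<chi> j. z * (v $ j + u))) :: real^'n \<Rightarrow> real"
  \<comment> \<open>The exponent \<open>c \<bullet> (x / z)\<close> is the linear form with coefficients \<open>c / z\<close>, so
    no change of variables is needed.\<close>
  have "has_bochner_integral lborel (\<lambda>x. ?I x * exp ((c /\<^sub>R z) \<bullet> x))
      (exp (z * ((c /\<^sub>R z) \<bullet> v)) * (\<Prod>j\<in>UNIV. exp (z * u * (c /\<^sub>R z) $ j) - 1) / (\<Prod>j\<in>UNIV. (c /\<^sub>R z) $ j))"
    by (rule has_bochner_integral_exp_scaled_cube) (use c u z in auto)
  also have "exp (z * ((c /\<^sub>R z) \<bullet> v)) * (\<Prod>j\<in>UNIV. exp (z * u * (c /\<^sub>R z) $ j) - 1)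
      = cube_exp_numerator 1"
  proof -
    have "z * ((c /\<^sub>R z) \<bullet> v) = c \<bullet> v" "z * u * (c /\<^sub>R z) $ j = u * c $ j" for j
      using z by (simp_all add: field_simps)
    then show ?thesis unfolding cube_exp_numerator_def by (simp only: mult_1_left)
  qed
  also have "(\<Prod>j\<in>UNIV. (c /\<^sub>R z) $ j) = (\<Prod>j\<in>UNIV. c $ j) / z ^ CARD('n)"
    by (simp add: prod.distrib power_inverse divide_inverse mult.commute)
  finally have 1: "has_bochner_integral lborel (\<lambda>x. z * (?I x * exp ((c /\<^sub>R z) \<bullet> x)))
      (z * (cube_exp_numerator 1 / ((\<Prod>j\<in>UNIV. c $ j) / z ^ CARD('n))))"
    by (rule has_bochner_integral_mult_right)
  have 2: "has_bochner_integral lborel (\<lambda>x. ?I x * exp (c \<bullet> x))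
      (cube_exp_numerator z / (\<Prod>j\<in>UNIV. c $ j))"
    unfolding cube_exp_numerator_def
    by (rule has_bochner_integral_exp_scaled_cube) (use c u z in auto)
  have 3: "has_bochner_integral lborel (\<lambda>x. (1 - z) * ?I x) ((1 - z) * (z * u) ^ CARD('n))"
    by (rule has_bochner_integral_mult_right, rule has_bochner_integral_scaled_cube) (use u z in auto)
  have "has_bochner_integral lborel
      (\<lambda>x. z * (?I x * exp ((c /\<^sub>R z) \<bullet> x)) - ?I x * exp (c \<bullet> x) + (1 - z) * ?I x)
      (z * (cube_exp_numerator 1 / ((\<Prod>j\<in>UNIV. c $ j) / z ^ CARD('n)))
        - cube_exp_numerator z / (\<Prod>j\<in>UNIV. c $ j) + (1 - z) * (z * u) ^ CARD('n))"
    by (intro has_bochner_integral_add has_bochner_integral_diff 1 2 3)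
  moreover have "z * (cube_exp_numerator 1 / ((\<Prod>j\<in>UNIV. c $ j) / z ^ CARD('n)))
        - cube_exp_numerator z / (\<Prod>j\<in>UNIV. c $ j) + (1 - z) * (z * u) ^ CARD('n) = gap_section z"
    by (simp add: gap_section_def diff_divide_distrib power_mult_distrib algebra_simps)
  moreover have "z * (?I x * exp ((c /\<^sub>R z) \<bullet> x)) - ?I x * exp (c \<bullet> x) + (1 - z) * ?I x
      = ?I x * (perspective (\<lambda>x. exp (c \<bullet> x) - 1) x z - (exp (c \<bullet> x) - 1))" for x
    by (simp add: perspective_def algebra_simps)
  ultimately show ?thesis by simp
qed

lemma has_integral_gap_section:
  "(gap_section has_integral
     1 / (\<Prod>j\<in>UNIV. c $ j) *
       (cube_exp_numerator 1 / (real CARD('n) + 2) - integral {0..1} cube_exp_numerator)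
     + u ^ CARD('n) / ((real CARD('n) + 1) * (real CARD('n) + 2))) {0..1}"
proof -
  let ?n = "CARD('n)" and ?C = "\<Prod>j\<in>UNIV. c $ j"
  have pow: "((\<lambda>z::real. z ^ k) has_integral 1 / (real k + 1)) {0..1}" for k
  proof -
    have "((\<lambda>z. z ^ Suc k / (real k + 1)) has_real_derivative z ^ k) (at z within {0..1})" for z :: real
      using DERIV_cdivide[OF DERIV_pow[of "Suc k" z "{0..1}"], of "real k + 1"] by (simp add: add.commute)
    then have "((\<lambda>z::real. z ^ k) has_integral 1 ^ Suc k / (real k + 1) - 0 ^ Suc k / (real k + 1)) {0..1}"
      by (intro fundamental_theorem_of_calculus) (auto simp flip: has_real_derivative_iff_has_vector_derivative)
    then show ?thesis by simp
  qed
  have "continuous_on {0..1} cube_exp_numerator"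
    unfolding cube_exp_numerator_def by (intro continuous_intros)
  then have J: "(cube_exp_numerator has_integral integral {0..1} cube_exp_numerator) {0..1}"
    by (intro integrable_integral integrable_continuous_real)
  have "((\<lambda>z. (z ^ (?n + 1) * cube_exp_numerator 1 - cube_exp_numerator z) / ?C
        + (z ^ ?n - z ^ (?n + 1)) * u ^ ?n) has_integral
      (1 / (real (?n + 1) + 1) * cube_exp_numerator 1 - integral {0..1} cube_exp_numerator) / ?C
        + (1 / (real ?n + 1) - 1 / (real (?n + 1) + 1)) * u ^ ?n) {0..1}"
    by (intro has_integral_add has_integral_diff has_integral_divide has_integral_mult_left pow J)
  moreover have "(1 / (real (?n + 1) + 1) * cube_exp_numerator 1 - integral {0..1} cube_exp_numerator) / ?C
        + (1 / (real ?n + 1) - 1 / (real (?n + 1) + 1)) * u ^ ?n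
      = 1 / ?C * (cube_exp_numerator 1 / (real ?n + 2) - integral {0..1} cube_exp_numerator)
        + u ^ ?n / ((real ?n + 1) * (real ?n + 2))"
  proof -
    have "1 / (real ?n + 1) - 1 / (real (?n + 1) + 1) = 1 / ((real ?n + 1) * (real ?n + 2))"
      by (simp add: divide_simps)
    then show ?thesis by (simp add: diff_divide_distrib)
  qed
  ultimately show ?thesis
    by (simp add: gap_section_def[abs_def])
qed

lemma lower_gap_exp_cube:
  assumes c: "\<And>j. c $ j \<noteq> 0" and u: "0 < u"
  defines "W \<equiv> 1 / (\<Prod>j\<in>UNIV. c $ j) *
       (cube_exp_numerator 1 / (real CARD('n) + 2) - integral {0..1} cube_exp_numerator)
     + u ^ CARD('n) / ((real CARD('n) + 1) * (real CARD('n) + 2))"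
  shows "lower_gap (\<lambda>x. exp (c \<bullet> x) - 1) (shifted_cube v u) \<in> lmeasurable"
    and "vol (lower_gap (\<lambda>x. exp (c \<bullet> x) - 1) (shifted_cube v u)) = W"
proof -
  let ?f = "\<lambda>x. exp (c \<bullet> x) - 1"
  define A where "A = {(x :: real^'n, z :: real). 0 < z \<and> z \<le> 1 \<and>
      (\<forall>j. z * v $ j \<le> x $ j \<and> x $ j \<le> z * (v $ j + u))}"
  define g where "g p = exp (c \<bullet> fst p) - 1" for p :: "(real^'n) \<times> real"
  define h where "h p = perspective ?f (fst p) (snd p)" for p :: "(real^'n) \<times> real"
  have A: "A = {p. 0 < snd p} \<inter> {p. snd p \<le> 1} \<inter>
      (\<Inter>j. {p. snd p * v $ j \<le> fst p $ j} \<inter> {p. fst p $ j \<le> snd p * (v $ j + u)})"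
    by (auto simp: A_def)
  have A_borel: "A \<in> sets borel"
    unfolding A
    by (intro sets.Int borel_open borel_closed closed_INT closed_Int ballI open_Collect_less
        closed_Collect_le continuous_intros)
  have g_borel: "g \<in> borel_measurable borel"
    unfolding g_def by (intro borel_measurable_continuous_onI continuous_intros)
  have h_borel: "h \<in> borel_measurable borel"
  proof -
    have snd: "(snd :: (real^'n) \<times> real \<Rightarrow> real) \<in> borel_measurable borel"
      and inner: "(\<lambda>p :: (real^'n) \<times> real. c \<bullet> fst p) \<in> borel_measurable borel"
      by (intro borel_measurable_continuous_onI continuous_intros)+
    have "(\<lambda>p :: (real^'n) \<times> real. snd p * (exp (inverse (snd p) * (c \<bullet> fst p)) - 1))
        \<in> borel_measurable borel"
      using snd inner by (intro borel_measurable_times borel_measurable_diff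
          borel_measurable_inverse borel_measurable_const measurable_compose[OF _ borel_measurable_exp])
    then show ?thesis by (simp add: h_def[abs_def] perspective_def)
  qed
  have gh: "g p \<le> h p" if "p \<in> A" for p
    using that perspective_convex_ge[OF convex_on_exp_inner[of c], of "snd p" "fst p"]
    by (auto simp: A_def g_def h_def)
  have "lower_gap ?f (shifted_cube v u) = {(x, y, z). (x, z) \<in> A \<and> g (x, z) \<le> y \<and> y < h (x, z)}"
    unfolding lower_gap_def shifted_cube_eq_cbox[OF u] A_def g_def h_def
    by (auto simp: mem_box_cart mem_scaleR_image_cbox_cart)
  note D = this emeasure_region_between_graphs[OF A_borel g_borel h_borel gh]
  have inner: "(\<integral>\<^sup>+x. ennreal (indicator A (x, z) * (h (x, z) - g (x, z))) \<partial>lborel)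
        = ennreal (indicator {0..1} z * gap_section z)"
    and nonneg: "z \<in> {0..1} \<Longrightarrow> 0 \<le> gap_section z" for z
  proof -
    have *: "(\<integral>\<^sup>+x. ennreal (indicator A (x, z) * (h (x, z) - g (x, z))) \<partial>lborel)
        = ennreal (gap_section z) \<and> 0 \<le> gap_section z" if z: "0 < z" "z \<le> 1"
    proof -
      have "indicator A (x, z) = (indicator (cbox (z *\<^sub>R v) (\<chi> j. z * (v $ j + u))) x :: real)" for x
        using z by (auto simp: A_def indicator_def mem_box_cart)
      then have hb: "has_bochner_integral lborel (\<lambda>x. indicator A (x, z) * (h (x, z) - g (x, z))) (gap_section z)"
        using has_bochner_integral_gap_section[OF c less_imp_le[OF u] z(1)] by (simp add: h_def g_def)
      have nn: "0 \<le> indicator A (x, z) * (h (x, z) - g (x, z))" for x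
        using gh[of "(x, z)"] by (auto simp: indicator_def)
      have "0 \<le> integral\<^sup>L lborel (\<lambda>x. indicator A (x, z) * (h (x, z) - g (x, z)))"
        by (intro Bochner_Integration.integral_nonneg nn)
      then have "0 \<le> gap_section z"
        unfolding has_bochner_integral_integral_eq[OF hb] .
      then show ?thesis
        using hb nn by (simp add: has_bochner_integral_iff nn_integral_eq_integral)
    qed
    show "(\<integral>\<^sup>+x. ennreal (indicator A (x, z) * (h (x, z) - g (x, z))) \<partial>lborel)
        = ennreal (indicator {0..1} z * gap_section z)"
    proof (cases "0 < z \<and> z \<le> 1")
      case False
      \<comment> \<open>The slice at \<open>z = 0\<close> is not in \<open>A\<close>, but it is in \<open>{0..1}\<close>: there \<open>gap_section\<close>
        vanishes.\<close>
      then have "indicator A (x, z) = (0 :: real)" for x by (auto simp: A_def)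
      moreover have "ennreal (indicator {0..1} z * gap_section z) = 0"
        using False gap_section_0 by (cases "z = 0") auto
      ultimately show ?thesis by (simp only: mult_zero_left ennreal_0 nn_integral_const)
    qed (use * in auto)
    show "0 \<le> gap_section z" if "z \<in> {0..1}"
      using that * gap_section_0 by (cases "z = 0") auto
  qed
  have W: "(gap_section has_integral W) {0..1}"
    unfolding W_def by (rule has_integral_gap_section)
  have "emeasure lborel (lower_gap ?f (shifted_cube v u)) = ennreal W"
    using nn_integral_has_integral_lebesgue[OF nonneg W] by (simp add: D inner)
  moreover have "0 \<le> W" using W nonneg by (rule has_integral_nonneg)
  moreover have "lower_gap ?f (shifted_cube v u) \<in> sets borel" using D by simp
  ultimately show "lower_gap ?f (shifted_cube v u) \<in> lmeasurable"
    and "vol (lower_gap ?f (shifted_cube v u)) = W"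
    by (auto simp: fmeasurable_def measure_def)
qed

end

theorem corollary3p10:
  fixes c v\<^sub>0 :: "real^'n" and u :: real
    and f \<mu> :: "real^'n \<Rightarrow> real" and Q :: "(real^'n) set"
    and P P\<^sub>0 :: "((real^'n) \<times> real \<times> real) set"
  assumes "\<And>j. c $ j \<noteq> 0"
    and "\<And>j. v\<^sub>0 $ j > 0"
    and "u > 0"
    and "f = (\<lambda>x. exp (c \<bullet> x) - 1)"
    and "Q = shifted_cube v\<^sub>0 u"
    and "concave_upper_bound f Q \<mu>"
    and "P = perspective_relaxation f \<mu> Q"
    and "P\<^sub>0 = naive_relaxation f \<mu> Q"
  shows "\<Delta> P\<^sub>0 P =
    1 / (\<Prod>j\<in>UNIV. c $ j) *
      (exp (c \<bullet> v\<^sub>0) * (\<Prod>j\<in>UNIV. (exp (u * c $ j) - 1)) / (real CARD('n) + 2)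
        - integral {0..1} (\<lambda>z. exp (z * (c \<bullet> v\<^sub>0)) * (\<Prod>j\<in>UNIV. (exp (z * u * c $ j) - 1))))
    + u ^ CARD('n) / ((real CARD('n) + 1) * (real CARD('n) + 2))"
proof -
  have Q: "Q = cbox v\<^sub>0 (\<chi> j. v\<^sub>0 $ j + u)"
    using assms by (simp add: shifted_cube_eq_cbox)
  define m where "m = (\<chi> j. v\<^sub>0 $ j + u / 2)"
  have sym: "2 *\<^sub>R m - q \<in> Q" if "q \<in> Q" for q
    using that by (auto simp: Q m_def mem_box_cart algebra_simps)
  have conc: "concave_on Q \<mu>" and f\<mu>: "\<And>q. q \<in> Q \<Longrightarrow> f q \<le> \<mu> q"
    using assms(6) by (auto simp: concave_upper_bound_def)
  have L: "-1 \<le> f q" for q by (simp add: assms(4))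
  have U: "\<mu> q \<le> 2 * \<mu> m - (-1)" if "q \<in> Q" for q
  proof (rule concave_on_symmetric_le[OF conc sym _ that])
    show "- 1 \<le> \<mu> q" if "q \<in> Q" for q using order_trans[OF L f\<mu>[OF that]] .
  qed
  have "\<Delta> P\<^sub>0 P = vol (lower_gap f Q)"
    unfolding assms(7,8)
  proof (rule Delta_relaxations_eq[where L = "-1" and U = "2 * \<mu> m - (-1)"])
    show "convex_on UNIV f" unfolding assms(4) by (rule convex_on_exp_inner)
    show "Q \<noteq> {}" using assms(3) by (auto simp: Q interval_ne_empty_cart)
    show "lower_gap f Q \<in> lmeasurable"
      unfolding assms(4,5) by (rule lower_gap_exp_cube) (use assms in auto)
    show "concave_upper_bound f Q \<mu>" by (rule assms(6))
  qed (use L U in \<open>auto simp: Q assms(4)\<close>)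
  also have "\<dots> = 1 / (\<Prod>j\<in>UNIV. c $ j) *
      (cube_exp_numerator c v\<^sub>0 u 1 / (real CARD('n) + 2) - integral {0..1} (cube_exp_numerator c v\<^sub>0 u))
    + u ^ CARD('n) / ((real CARD('n) + 1) * (real CARD('n) + 2))"
    unfolding assms(4,5) by (rule lower_gap_exp_cube) (use assms in auto)
  finally show ?thesis
    by (simp add: cube_exp_numerator_def[abs_def])
qed

end
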